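(* Let $R$ be an arbitrary unital associative and commutative ring and let $A$ be a unital associative $R$-algebra generated by a set $X$. Let $U$ be a two-sided ideal in $A$ generated by a set $S$. Let $I'$ be the two-sided ideal of $A$ generated by all elements \[ [s, x_1, x_2] \qquad \text{and} \qquad [s, x_1][x_2, x_3] + [s, x_2][x_1, x_3] \qquad (s \in S, \ x_i \in X). \] Then, for each element $v = [s, x_1][x_2, x_3, x_4]$ with $s \in S$ and $x_1,x_2,x_3,x_4 \in X$, we have $3\,v \in I'$. In particular, if $3$ is invertible in $R$ then $v \in I'$.
   Context: Commutators are additive and left-normed: $[a_1,a_2] = a_1a_2 - a_2a_1$ and $[a_1,a_2,a_3] = \bigl[[a_1,a_2],a_3\bigr]$. "Generated by $X$" means generated as a unital $R$-algebra. *)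

theory Defs
  imports "HOL-Algebra.Module" "HOL-Algebra.Ideal" "HOL-Algebra.Subrings"
begin

text \<open>
  The locale \<^locale>\<open>algebra\<close> of HOL-Algebra requires the algebra to be a commutative ring, so unital
  associative algebras over a commutative ring are introduced here. As in the library, the zero
  ring is admitted both for the scalars and for the algebra.
\<close>

locale assoc_algebra = module R A + ring A for R and A (structure) +
  assumes smult_mult_left:
      "\<lbrakk>r \<in> carrier R; x \<in> carrier A; y \<in> carrier A\<rbrakk> \<Longrightarrow>
        (r \<odot> x) \<otimes> y = r \<odot> (x \<otimes> y)"
    and smult_mult_right:
      "\<lbrakk>r \<in> carrier R; x \<in> carrier A; y \<in> carrier A\<rbrakk> \<Longrightarrow>
        x \<otimes> (r \<odot> y) = r \<odot> (x \<otimes> y)"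

text \<open>
  Intersection of all unital \<open>R\<close>-subalgebras of \<open>A\<close> containing \<open>X\<close>; meaningful only for
  \<open>X \<subseteq> carrier A\<close>.
\<close>

definition generated_subalgebra ::
    "('r, 'm) ring_scheme \<Rightarrow> ('r, 'a, 'n) module_scheme \<Rightarrow> 'a set \<Rightarrow> 'a set"
  where "generated_subalgebra R A X = \<Inter>{B. subring B A \<and> submodule B R A \<and> X \<subseteq> B}"

definition commutator :: "('a, 'm) ring_scheme \<Rightarrow> 'a \<Rightarrow> 'a \<Rightarrow> 'a"
  where "commutator A a b = (a \<otimes>\<^bsub>A\<^esub> b) \<ominus>\<^bsub>A\<^esub> (b \<otimes>\<^bsub>A\<^esub> a)"

definition commutator3 :: "('a, 'm) ring_scheme \<Rightarrow> 'a \<Rightarrow> 'a \<Rightarrow> 'a \<Rightarrow> 'a"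
  where "commutator3 A a b c = commutator A (commutator A a b) c"

end

theory Submission
  imports Defs "HOL-Algebra.QuotRing"
begin

text \<open>
  Pass to the quotient of \<open>A\<close> by \<open>I'\<close>, and write \<open>c x\<close> for the image of \<open>[s, x]\<close>, \<open>x \<in> X\<close>. The
  relations \<open>[s, x, y] = 0\<close> say that \<open>c x\<close> commutes with the generators, so \<open>c x\<close> is central. The
  remaining relations then say that \<open>c x \<otimes> y \<oplus> c y \<otimes> x\<close> commutes with the generators, so this
  element is central as well, which amounts to \<open>c x \<otimes> [y, a] = \<ominus> c y \<otimes> [x, a]\<close> for every \<open>a\<close>,
  and not only for generators. Both conclusions are instances of
  \<open>hom_image_central_if_commutes_with_generators\<close>.

  The case \<open>a = [z, w]\<close> shows that \<open>c x \<otimes> [z, w, y]\<close> changes sign when \<open>x\<close> and \<open>y\<close> are swapped.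
  Together with the skewness of \<open>c x \<otimes> [y, z]\<close> this makes \<open>c x \<otimes> [y, z, w]\<close> skew in all of
  \<open>x, y, z, w\<close>. A cyclic shift of \<open>y, z, w\<close> is an even permutation, so the three terms of the
  Jacobi identity, multiplied by \<open>c x\<close>, are all equal; this is where the factor 3 arises
  (\<open>three_mult_commutator3_eq_zero_if_skew\<close>).

  Since only the vanishing of the relations matters, the argument is carried out for an arbitrary
  ring homomorphism from \<open>A\<close> that kills them.
\<close>

section \<open>Commutators in a ring\<close>

context ring
begin

lemma commutator_closed [simp, intro]:
  "\<lbrakk>a \<in> carrier R; b \<in> carrier R\<rbrakk> \<Longrightarrow> commutator R a b \<in> carrier R"
  by (simp add: commutator_def)

lemma commutator_swap:
  "\<lbrakk>a \<in> carrier R; b \<in> carrier R\<rbrakk> \<Longrightarrow> commutator R b a = \<ominus> commutator R a b"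
  by (simp add: commutator_def minus_eq minus_add a_comm)

lemma commutator_eq_zero_iff:
  "\<lbrakk>a \<in> carrier R; b \<in> carrier R\<rbrakk> \<Longrightarrow> commutator R a b = \<zero> \<longleftrightarrow> a \<otimes> b = b \<otimes> a"
  by (simp add: commutator_def)

lemma commutator_add_left:
  "\<lbrakk>a \<in> carrier R; b \<in> carrier R; d \<in> carrier R\<rbrakk> \<Longrightarrow>
    commutator R (a \<oplus> b) d = commutator R a d \<oplus> commutator R b d"
  by (simp add: commutator_def minus_eq l_distr r_distr minus_add a_ac)

lemma commutator_mult_central_left:
  assumes "c \<in> carrier R" "a \<in> carrier R" "b \<in> carrier R" "c \<otimes> b = b \<otimes> c"
  shows "commutator R (c \<otimes> a) b = c \<otimes> commutator R a b"
proof -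
  have "b \<otimes> (c \<otimes> a) = c \<otimes> (b \<otimes> a)"
    using assms by (metis m_assoc)
  then show ?thesis
    using assms by (simp add: commutator_def minus_eq r_distr r_minus m_assoc)
qed

lemma jacobi:
  assumes "a \<in> carrier R" "b \<in> carrier R" "d \<in> carrier R"
  shows "commutator3 R a b d \<oplus> commutator3 R b d a \<oplus> commutator3 R d a b = \<zero>"
proof -
  let ?u = "(a \<otimes> b \<otimes> d \<oplus> b \<otimes> d \<otimes> a \<oplus> d \<otimes> a \<otimes> b) \<oplus> (a \<otimes> d \<otimes> b \<oplus> b \<otimes> a \<otimes> d \<oplus> d \<otimes> b \<otimes> a)"
  \<comment> \<open>Each of the six products of \<open>a, b, d\<close> occurs once with either sign.\<close>
  have "commutator3 R a b d \<oplus> commutator3 R b d a \<oplus> commutator3 R d a b = ?u \<oplus> \<ominus> ?u"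
    using assms
    by (simp add: commutator3_def commutator_def minus_eq l_distr r_distr l_minus r_minus
        minus_add m_assoc a_ac del: r_neg)
  also have "\<dots> = \<zero>"
    using assms by (intro r_neg) auto
  finally show ?thesis .
qed

text \<open>
  Write \<open>g i j k l\<close> for \<open>c i \<otimes> [p j, p k, p l]\<close>. Since \<open>c i\<close> commutes with \<open>p l\<close>, this is the
  commutator of \<open>c i \<otimes> [p j, p k]\<close> with \<open>p l\<close>, so that it inherits from \<open>c i \<otimes> [p j, p k]\<close> the sign
  change under every transposition of \<open>i, j, k\<close>; the second skewness hypothesis gives the sign
  change when \<open>i\<close> and \<open>l\<close> are swapped. Hence \<open>g\<close> is skew in all four arguments and therefore
  invariant under the cyclic shifts of \<open>j, k, l\<close>, and the three shifted values add up to zero by the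
  Jacobi identity.
\<close>

lemma three_mult_commutator3_eq_zero_if_skew:
  assumes p: "\<And>i. i \<in> J \<Longrightarrow> p i \<in> carrier R"
    and c: "\<And>i. i \<in> J \<Longrightarrow> c i \<in> carrier R"
    and commutes: "\<And>i j. \<lbrakk>i \<in> J; j \<in> J\<rbrakk> \<Longrightarrow> c i \<otimes> p j = p j \<otimes> c i"
    and skew2: "\<And>i j k. \<lbrakk>i \<in> J; j \<in> J; k \<in> J\<rbrakk> \<Longrightarrow>
        c i \<otimes> commutator R (p j) (p k) \<oplus> c j \<otimes> commutator R (p i) (p k) = \<zero>"
    and skew3: "\<And>i j k l. \<lbrakk>i \<in> J; j \<in> J; k \<in> J; l \<in> J\<rbrakk> \<Longrightarrow>
        c i \<otimes> commutator R (p j) (commutator R (p k) (p l)) \<oplus>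
        c j \<otimes> commutator R (p i) (commutator R (p k) (p l)) = \<zero>"
    and elems: "i \<in> J" "j \<in> J" "k \<in> J" "l \<in> J"
  shows "[(3::nat)] \<cdot> (c i \<otimes> commutator3 R (p j) (p k) (p l)) = \<zero>"
proof -
  define g where "g = (\<lambda>i j k l. c i \<otimes> commutator3 R (p j) (p k) (p l))"
  have gc: "g i j k l \<in> carrier R" if "i \<in> J" "j \<in> J" "k \<in> J" "l \<in> J" for i j k l
    using that c p by (simp add: g_def commutator3_def)
  have rotate_pair: "c i \<otimes> commutator R (p j) (p k) = c k \<otimes> commutator R (p i) (p j)"
    if "i \<in> J" "j \<in> J" "k \<in> J" for i j k
  proof -
    have "c i \<otimes> commutator R (p j) (p k) = \<ominus> (c i \<otimes> commutator R (p k) (p j))"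
      using that c p by (simp add: commutator_swap[of "p k" "p j"] r_minus)
    also have "\<dots> = c k \<otimes> commutator R (p i) (p j)"
      using that c p skew2[of k i j] by (intro minus_equality) auto
    finally show ?thesis .
  qed
  have rotate_first: "g i j k l = g k i j l"
    if "i \<in> J" "j \<in> J" "k \<in> J" "l \<in> J" for i j k l
  proof -
    have "g i j k l = commutator R (c i \<otimes> commutator R (p j) (p k)) (p l)"
      using that c p commutes
      by (simp add: g_def commutator3_def commutator_mult_central_left)
    also have "\<dots> = commutator R (c k \<otimes> commutator R (p i) (p j)) (p l)"
      using that by (simp add: rotate_pair[of i j k])
    also have "\<dots> = g k i j l"
      using that c p commutes
      by (simp add: g_def commutator3_def commutator_mult_central_left)
    finally show ?thesis .
  qed
  have swap_ends: "g i j k l = \<ominus> g l j k i"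
    if J: "i \<in> J" "j \<in> J" "k \<in> J" "l \<in> J" for i j k l
  proof -
    have "g a j k b = \<ominus> (c a \<otimes> commutator R (p b) (commutator R (p j) (p k)))"
      if "a \<in> J" "b \<in> J" for a b
      using that J c p
      by (simp add: g_def commutator3_def commutator_swap[of "p b"] r_minus)
    moreover have "c i \<otimes> commutator R (p l) (commutator R (p j) (p k)) =
        \<ominus> (c l \<otimes> commutator R (p i) (commutator R (p j) (p k)))"
      using J c p skew3[of i l j k] by (intro minus_equality[symmetric]) auto
    ultimately show ?thesis
      using J by simp
  qed
  have rotate_last: "g i k l j = g i j k l"
    if "i \<in> J" "j \<in> J" "k \<in> J" "l \<in> J" for i j k l
  proof -
    have "g i k l j = \<ominus> g j k l i"
      using that by (intro swap_ends)
    also have "\<dots> = \<ominus> g l j k i"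
      using that by (simp add: rotate_first[of j k l i])
    also have "\<dots> = g i j k l"
      using that by (simp add: swap_ends[of i j k l])
    finally show ?thesis .
  qed
  have "g i j k l \<oplus> g i k l j \<oplus> g i l j k
      = c i \<otimes> (commutator3 R (p j) (p k) (p l) \<oplus> commutator3 R (p k) (p l) (p j)
          \<oplus> commutator3 R (p l) (p j) (p k))"
    using elems c p by (simp add: g_def commutator3_def r_distr)
  also have "\<dots> = \<zero>"
    using elems c p by (simp add: jacobi)
  also have "g i l j k = g i j k l"
    using elems rotate_last[of i k l j] rotate_last[of i j k l] by simp
  also have "g i k l j = g i j k l"
    using elems by (intro rotate_last)
  finally have "g i j k l \<oplus> g i j k l \<oplus> g i j k l = \<zero>" .
  then show ?thesis
    using gc[OF elems] by (simp add: numeral_3_eq_3 g_def)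
qed

end

lemma (in ring_hom_ring) hom_commutator:
  assumes "a \<in> carrier R" "b \<in> carrier R"
  shows "h (commutator R a b) = commutator S (h a) (h b)"
  using assms by (simp add: commutator_def R.minus_eq S.minus_eq)

section \<open>Algebras and their generators\<close>

context assoc_algebra
begin

lemma smult_eq_smult_one_mult:
  "\<lbrakk>r \<in> carrier R; a \<in> carrier A\<rbrakk> \<Longrightarrow> r \<odot> a = (r \<odot> \<one>) \<otimes> a"
  by (simp add: smult_mult_left)

lemma ideal_smult_closed:
  assumes "ideal I A" "r \<in> carrier R" "a \<in> I"
  shows "r \<odot> a \<in> I"
proof -
  interpret ideal I A by fact
  have "a \<in> carrier A"
    using a_subset assms(3) by blast
  then show ?thesis
    using assms I_l_closed[of a "r \<odot> \<one>"] by (simp add: smult_eq_smult_one_mult[of r a])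
qed

lemma nat_multiple_smult:
  assumes "r \<in> carrier R" "a \<in> carrier A"
  shows "([(n::nat)] \<cdot>\<^bsub>R\<^esub> r) \<odot> a = [n] \<cdot>\<^bsub>A\<^esub> (r \<odot> a)"
  using assms by (induction n) (simp_all add: smult_l_distr)

text \<open>
  The elements whose image commutes with \<open>h z\<close> form a subalgebra: scalar multiples cause no
  trouble, because \<open>z \<otimes> (r \<odot> a)\<close> and \<open>(r \<odot> a) \<otimes> z\<close> are the multiples of \<open>z \<otimes> a\<close> and \<open>a \<otimes> z\<close> by the
  same element \<open>r \<odot> \<one>\<close>. This also works when the target of \<open>h\<close> carries no scalar action.
\<close>

lemma hom_image_central_if_commutes_with_generators:
  assumes hom: "ring_hom_ring A Q h"
    and X: "X \<subseteq> carrier A"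
    and gen: "generated_subalgebra R A X = carrier A"
    and z: "z \<in> carrier A"
    and comm: "\<And>x. x \<in> X \<Longrightarrow> h z \<otimes>\<^bsub>Q\<^esub> h x = h x \<otimes>\<^bsub>Q\<^esub> h z"
    and a: "a \<in> carrier A"
  shows "h z \<otimes>\<^bsub>Q\<^esub> h a = h a \<otimes>\<^bsub>Q\<^esub> h z"
proof -
  interpret h: ring_hom_ring A Q h by fact
  define B where "B = {b \<in> carrier A. h z \<otimes>\<^bsub>Q\<^esub> h b = h b \<otimes>\<^bsub>Q\<^esub> h z}"
  have sub: "subring B A"
  proof (rule subringI)
    fix b1 b2 assume b: "b1 \<in> B" "b2 \<in> B"
    then have "h z \<otimes>\<^bsub>Q\<^esub> (h b1 \<otimes>\<^bsub>Q\<^esub> h b2) = (h b1 \<otimes>\<^bsub>Q\<^esub> h b2) \<otimes>\<^bsub>Q\<^esub> h z"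
      using z unfolding B_def
      by (smt (verit) h.S.m_assoc h.hom_closed mem_Collect_eq)
    then show "b1 \<otimes> b2 \<in> B"
      using b by (simp add: B_def)
    show "b1 \<oplus> b2 \<in> B"
      using b z by (simp add: B_def h.S.l_distr h.S.r_distr)
  next
    fix b assume "b \<in> B"
    then show "\<ominus> b \<in> B"
      using z by (simp add: B_def h.S.l_minus h.S.r_minus)
  qed (use z in \<open>auto simp: B_def\<close>)
  have smult: "r \<odot> b \<in> B" if r: "r \<in> carrier R" and b: "b \<in> B" for r b
  proof -
    have bA: "b \<in> carrier A" and hb: "h (z \<otimes> b) = h (b \<otimes> z)"
      using b z by (auto simp: B_def)
    have "z \<otimes> (r \<odot> b) = (r \<odot> \<one>) \<otimes> (z \<otimes> b)" "(r \<odot> b) \<otimes> z = (r \<odot> \<one>) \<otimes> (b \<otimes> z)"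
      using r z bA by (simp_all add: smult_mult_left smult_mult_right)
    then have "h (z \<otimes> (r \<odot> b)) = h ((r \<odot> b) \<otimes> z)"
      using h.hom_mult[of "r \<odot> \<one>" "z \<otimes> b"] h.hom_mult[of "r \<odot> \<one>" "b \<otimes> z"] r z bA hb
      by (simp only: m_closed smult_closed one_closed)
    then show ?thesis
      using r z bA by (simp add: B_def)
  qed
  have "submodule B R A"
    using subring.axioms(1)[OF sub] smult
    by (intro submodule.intro submodule_axioms.intro)
  with sub have "generated_subalgebra R A X \<subseteq> B"
    using X comm unfolding generated_subalgebra_def by (intro Inter_lower) (auto simp: B_def)
  with gen a show ?thesis
    by (auto simp: B_def)
qed

text \<open>
  Skewness, assumed for generators only, holds with an arbitrary element in the last place: as
  the images of \<open>[s, x]\<close> and \<open>[s, y]\<close> are central in the range of \<open>h\<close>, the element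
  \<open>[s, x] \<otimes> [y, a] \<oplus> [s, y] \<otimes> [x, a]\<close> has the same image as the commutator of
  \<open>t = [s, x] \<otimes> y \<oplus> [s, y] \<otimes> x\<close> with \<open>a\<close>, and the image of \<open>t\<close> commutes with that of every \<open>a\<close>
  as soon as it commutes with those of the generators.
\<close>

lemma hom_three_commutator_mult_commutator3_eq_zero:
  assumes hom: "ring_hom_ring A Q h"
    and X: "X \<subseteq> carrier A"
    and gen: "generated_subalgebra R A X = carrier A"
    and s: "s \<in> carrier A"
    and killed_commutator3: "\<And>x y. \<lbrakk>x \<in> X; y \<in> X\<rbrakk> \<Longrightarrow> h (commutator3 A s x y) = \<zero>\<^bsub>Q\<^esub>"
    and killed_skew: "\<And>x y z. \<lbrakk>x \<in> X; y \<in> X; z \<in> X\<rbrakk> \<Longrightarrow>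
        h (commutator A s x \<otimes> commutator A y z \<oplus> commutator A s y \<otimes> commutator A x z) = \<zero>\<^bsub>Q\<^esub>"
    and elems: "x1 \<in> X" "x2 \<in> X" "x3 \<in> X" "x4 \<in> X"
  shows "h ([(3::nat)] \<cdot> (commutator A s x1 \<otimes> commutator3 A x2 x3 x4)) = \<zero>\<^bsub>Q\<^esub>"
proof -
  interpret h: ring_hom_ring A Q h by fact
  define c where "c = (\<lambda>x. h (commutator A s x))"
  have XA: "x \<in> carrier A" if "x \<in> X" for x
    using X that by blast
  have c: "c x \<in> carrier Q" if "x \<in> X" for x
    using that XA s by (simp add: c_def)
  have central: "c x \<otimes>\<^bsub>Q\<^esub> h a = h a \<otimes>\<^bsub>Q\<^esub> c x" if x: "x \<in> X" and a: "a \<in> carrier A" for x a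
    unfolding c_def
  proof (rule hom_image_central_if_commutes_with_generators[OF hom X gen _ _ a])
    fix y assume y: "y \<in> X"
    have "commutator Q (h (commutator A s x)) (h y) = \<zero>\<^bsub>Q\<^esub>"
      using killed_commutator3[OF x y] x y s XA
      by (simp add: commutator3_def h.hom_commutator)
    then show "h (commutator A s x) \<otimes>\<^bsub>Q\<^esub> h y = h y \<otimes>\<^bsub>Q\<^esub> h (commutator A s x)"
      using x y s XA by (simp add: h.S.commutator_eq_zero_iff)
  qed (use x s XA in simp)
  have skew: "c x \<otimes>\<^bsub>Q\<^esub> commutator Q (h y) (h a) \<oplus>\<^bsub>Q\<^esub> c y \<otimes>\<^bsub>Q\<^esub> commutator Q (h x) (h a) = \<zero>\<^bsub>Q\<^esub>"
    if x: "x \<in> X" and y: "y \<in> X" and a: "a \<in> carrier A" for x y a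
  proof -
    define t where "t = commutator A s x \<otimes> y \<oplus> commutator A s y \<otimes> x"
    have tA: "t \<in> carrier A"
      using x y s XA by (simp add: t_def)
    have commutator_t: "commutator Q (h t) (h b)
        = c x \<otimes>\<^bsub>Q\<^esub> commutator Q (h y) (h b) \<oplus>\<^bsub>Q\<^esub> c y \<otimes>\<^bsub>Q\<^esub> commutator Q (h x) (h b)"
      if b: "b \<in> carrier A" for b
    proof -
      have "h t = c x \<otimes>\<^bsub>Q\<^esub> h y \<oplus>\<^bsub>Q\<^esub> c y \<otimes>\<^bsub>Q\<^esub> h x"
        using x y s XA by (simp add: t_def c_def)
      then show ?thesis
        using x y b XA c central[OF x b] central[OF y b]
        by (simp add: h.S.commutator_add_left h.S.commutator_mult_central_left)
    qed
    have "h t \<otimes>\<^bsub>Q\<^esub> h a = h a \<otimes>\<^bsub>Q\<^esub> h t"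
    proof (rule hom_image_central_if_commutes_with_generators[OF hom X gen tA _ a])
      fix z assume z: "z \<in> X"
      have "commutator Q (h t) (h z) = \<zero>\<^bsub>Q\<^esub>"
        using killed_skew[OF x y z] x y z s XA
        by (simp add: commutator_t c_def h.hom_commutator)
      then show "h t \<otimes>\<^bsub>Q\<^esub> h z = h z \<otimes>\<^bsub>Q\<^esub> h t"
        using tA z XA by (simp add: h.S.commutator_eq_zero_iff)
    qed
    then show ?thesis
      using tA a by (simp add: commutator_t[symmetric] h.S.commutator_eq_zero_iff)
  qed
  have "[(3::nat)] \<cdot>\<^bsub>Q\<^esub> (c x1 \<otimes>\<^bsub>Q\<^esub> commutator3 Q (h x2) (h x3) (h x4)) = \<zero>\<^bsub>Q\<^esub>"
  proof (rule h.S.three_mult_commutator3_eq_zero_if_skew[where J = X])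
    show "c x \<otimes>\<^bsub>Q\<^esub> commutator Q (h y) (commutator Q (h z) (h w)) \<oplus>\<^bsub>Q\<^esub>
        c y \<otimes>\<^bsub>Q\<^esub> commutator Q (h x) (commutator Q (h z) (h w)) = \<zero>\<^bsub>Q\<^esub>"
      if "x \<in> X" "y \<in> X" "z \<in> X" "w \<in> X" for x y z w
      using that XA skew[of x y "commutator A z w"] by (simp add: h.hom_commutator)
  qed (use XA c central skew elems in auto)
  then show ?thesis
    using elems s XA
    by (simp add: numeral_3_eq_3 c_def commutator3_def h.hom_commutator)
qed

end

section \<open>The ideal generated by the relations\<close>

theorem proposition1p5:
  fixes R :: "('r, 'm) ring_scheme"
    and A :: "('r, 'a, 'n) module_scheme"
    and X S U I' :: "'a set"
  assumes "assoc_algebra R A"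
    and "X \<subseteq> carrier A"
    and "generated_subalgebra R A X = carrier A"
    and "S \<subseteq> carrier A"
    and "U = Idl\<^bsub>A\<^esub> S"
    and "I' = Idl\<^bsub>A\<^esub>
          ({commutator3 A s x1 x2 | s x1 x2. s \<in> S \<and> x1 \<in> X \<and> x2 \<in> X} \<union>
           {(commutator A s x1 \<otimes>\<^bsub>A\<^esub> commutator A x2 x3) \<oplus>\<^bsub>A\<^esub>
            (commutator A s x2 \<otimes>\<^bsub>A\<^esub> commutator A x1 x3)
              | s x1 x2 x3. s \<in> S \<and> x1 \<in> X \<and> x2 \<in> X \<and> x3 \<in> X})"
  shows "\<forall>s\<in>S. \<forall>x1\<in>X. \<forall>x2\<in>X. \<forall>x3\<in>X. \<forall>x4\<in>X. \<forall>v.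
           v = commutator A s x1 \<otimes>\<^bsub>A\<^esub> commutator3 A x2 x3 x4 \<longrightarrow>
             [(3::nat)] \<cdot>\<^bsub>A\<^esub> v \<in> I' \<and>
             ([(3::nat)] \<cdot>\<^bsub>R\<^esub> \<one>\<^bsub>R\<^esub> \<in> Units R \<longrightarrow> v \<in> I')"
proof (intro ballI allI impI, goal_cases)
  case (1 s x1 x2 x3 x4 v)
  interpret assoc_algebra R A by fact
  let ?G = "{commutator3 A s x1 x2 | s x1 x2. s \<in> S \<and> x1 \<in> X \<and> x2 \<in> X} \<union>
           {(commutator A s x1 \<otimes>\<^bsub>A\<^esub> commutator A x2 x3) \<oplus>\<^bsub>A\<^esub>
            (commutator A s x2 \<otimes>\<^bsub>A\<^esub> commutator A x1 x3)
              | s x1 x2 x3. s \<in> S \<and> x1 \<in> X \<and> x2 \<in> X \<and> x3 \<in> X}"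
  have SA: "s \<in> carrier A" if "s \<in> S" for s
    using assms(4) that by blast
  have XA: "x \<in> carrier A" if "x \<in> X" for x
    using assms(2) that by blast
  have G: "?G \<subseteq> carrier A"
    by (auto simp: commutator3_def SA XA)
  have I': "ideal I' A"
    unfolding assms(6) by (rule genideal_ideal[OF G])
  interpret I': ideal I' A by (rule I')
  have killed: "I' +>\<^bsub>A\<^esub> a = \<zero>\<^bsub>A Quot I'\<^esub>" if "a \<in> ?G" for a
  proof -
    have "a \<in> I'"
      using genideal_self[OF G] that unfolding assms(6) by (rule subsetD)
    then show ?thesis
      by (simp add: I'.a_rcos_const FactRing_def)
  qed
  have v: "v \<in> carrier A"
    using 1 SA XA by (simp add: commutator3_def)
  have "I' +>\<^bsub>A\<^esub> ([(3::nat)] \<cdot>\<^bsub>A\<^esub> v) = \<zero>\<^bsub>A Quot I'\<^esub>"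
    unfolding \<open>v = _\<close>
  proof (rule hom_three_commutator_mult_commutator3_eq_zero
      [OF I'.rcos_ring_hom_ring assms(2,3) SA[OF \<open>s \<in> S\<close>]])
    fix x y assume "x \<in> X" "y \<in> X"
    then show "I' +>\<^bsub>A\<^esub> commutator3 A s x y = \<zero>\<^bsub>A Quot I'\<^esub>"
      using \<open>s \<in> S\<close> by (intro killed UnI1) blast
  next
    fix x y z assume "x \<in> X" "y \<in> X" "z \<in> X"
    then show "I' +>\<^bsub>A\<^esub> (commutator A s x \<otimes>\<^bsub>A\<^esub> commutator A y z \<oplus>\<^bsub>A\<^esub>
        commutator A s y \<otimes>\<^bsub>A\<^esub> commutator A x z) = \<zero>\<^bsub>A Quot I'\<^esub>"
      using \<open>s \<in> S\<close> by (intro killed UnI2) blast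
  qed (fact 1)+
  then have three_v: "[(3::nat)] \<cdot>\<^bsub>A\<^esub> v \<in> I'"
    using I'.a_rcos_self[of "[(3::nat)] \<cdot>\<^bsub>A\<^esub> v"] v by (simp add: FactRing_def)
  moreover have "v \<in> I'" if unit: "[(3::nat)] \<cdot>\<^bsub>R\<^esub> \<one>\<^bsub>R\<^esub> \<in> Units R"
  proof -
    let ?u = "inv\<^bsub>R\<^esub> ([(3::nat)] \<cdot>\<^bsub>R\<^esub> \<one>\<^bsub>R\<^esub>)"
    have u: "?u \<in> carrier R"
      using unit by simp
    have "?u \<odot>\<^bsub>A\<^esub> ([(3::nat)] \<cdot>\<^bsub>A\<^esub> v) = ?u \<odot>\<^bsub>A\<^esub> (([(3::nat)] \<cdot>\<^bsub>R\<^esub> \<one>\<^bsub>R\<^esub>) \<odot>\<^bsub>A\<^esub> v)"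
      using v by (simp add: nat_multiple_smult)
    also have "\<dots> = v"
      using u unit v by (simp add: smult_assoc1[symmetric])
    finally show ?thesis
      using ideal_smult_closed[OF I' u three_v] by simp
  qed
  ultimately show ?case by blast
qed

end
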